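(* Let $n,p\ge 1$ be integers, let $y_1,\dots,y_n\in\mathbb{R}$ and $x_1,\dots,x_n\in\mathbb{R}^p$ be given data, and let $\lambda>0$ and $c\in\mathbb{R}$ be given constants. Consider the M-estimation problem with concomitant scale $$(\widehat\beta_M,\widehat\sigma_M)\in\operatorname*{arg\,min}_{\beta\in\mathbb{R}^p,\ \sigma>0}\left\{\sum_{i=1}^n\rho\left(\frac{y_i-x_i'\beta}{\sigma},\lambda\right)+2cn\log\sigma\right\}$$ and the penalized weighted least squares (PWLS) problem with the same concomitant scale $$(\widehat\beta_P,\widehat\sigma_P,\widehat w_P)\in\operatorname*{arg\,min}_{\beta\in\mathbb{R}^p,\ \sigma>0,\ w\in(0,\infty)^n}\left\{\frac{1}{\sigma^2}\sum_{i=1}^n w_i^2(y_i-x_i'\beta)^2+\sum_{i=1}^n\lambda|\log(w_i)|+2cn\log\sigma\right\}.$$ Then the M-estimator $\widehat\beta_M$ is the same as the PWLS estimator $\widehat\beta_P$; that is, a vector $\beta\in\mathbb{R}^p$ is the $\beta$-component of a minimizer of the first problem if and only if it is the $\beta$-component of a minimizer of the second problem.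
   Context: Here $x'$ denotes the transpose of $x$, so $x_i'\beta$ is the Euclidean inner product. For $\lambda>0$, the function $\rho(\cdot,\lambda):\mathbb{R}\to\mathbb{R}$ is defined by $$\rho(t,\lambda)=\begin{cases}\lambda\log\left(|t|\sqrt{2/\lambda}\right)+\lambda/2, & \text{if } |t|>\sqrt{\lambda/2},\\ t^2, & \text{if } |t|\le\sqrt{\lambda/2}.\end{cases}$$ Minimizers ("arg min") are global minimizers over the indicated domains; they need not be unique. *)

theory Defs
  imports "HOL-Analysis.Analysis"
begin

definition rho :: "real \<Rightarrow> real \<Rightarrow> real" where
  "rho t lam =
     (if \<bar>t\<bar> > sqrt (lam / 2) then lam * ln (\<bar>t\<bar> * sqrt (2 / lam)) + lam / 2 else t\<^sup>2)"

text \<open>Observations are indexed by the finite type \<open>'n\<close> (so the sample size is \<open>CARD('n)\<close>);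
  row \<open>x $ i\<close> of the design matrix is the covariate vector of observation \<open>i\<close>.\<close>

definition M_objective ::
  "real ^ 'n \<Rightarrow> real ^ 'p ^ 'n \<Rightarrow> real \<Rightarrow> real \<Rightarrow> (real ^ 'p) \<times> real \<Rightarrow> real" where
  "M_objective y x lam c = (\<lambda>(\<beta>, \<sigma>).
     (\<Sum>i\<in>UNIV. rho ((y $ i - x $ i \<bullet> \<beta>) / \<sigma>) lam) + 2 * c * real CARD('n) * ln \<sigma>)"

definition PWLS_objective ::
  "real ^ 'n \<Rightarrow> real ^ 'p ^ 'n \<Rightarrow> real \<Rightarrow> real \<Rightarrow> (real ^ 'p) \<times> real \<times> (real ^ 'n) \<Rightarrow> real" where
  "PWLS_objective y x lam c = (\<lambda>(\<beta>, \<sigma>, w).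
     1 / \<sigma>\<^sup>2 * (\<Sum>i\<in>UNIV. (w $ i)\<^sup>2 * (y $ i - x $ i \<bullet> \<beta>)\<^sup>2)
       + (\<Sum>i\<in>UNIV. lam * \<bar>ln (w $ i)\<bar>) + 2 * c * real CARD('n) * ln \<sigma>)"

definition is_M_minimizer ::
  "real ^ 'n \<Rightarrow> real ^ 'p ^ 'n \<Rightarrow> real \<Rightarrow> real \<Rightarrow> (real ^ 'p) \<times> real \<Rightarrow> bool" where
  "is_M_minimizer y x lam c = is_arg_min (M_objective y x lam c) (\<lambda>(\<beta>, \<sigma>). \<sigma> > 0)"

definition is_PWLS_minimizer ::
  "real ^ 'n \<Rightarrow> real ^ 'p ^ 'n \<Rightarrow> real \<Rightarrow> real \<Rightarrow> (real ^ 'p) \<times> real \<times> (real ^ 'n) \<Rightarrow> bool" where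
  "is_PWLS_minimizer y x lam c =
     is_arg_min (PWLS_objective y x lam c) (\<lambda>(\<beta>, \<sigma>, w). \<sigma> > 0 \<and> (\<forall>i. w $ i > 0))"

end

theory Submission
  imports Defs
begin

text \<open>Minimising the PWLS criterion over the weights alone, one observation at a time, gives
  \<open>rho\<close>: with residual \<open>t\<close>, the function \<open>w\<^sup>2 t\<^sup>2 + lam \<bar>ln w\<bar>\<close> of \<open>w > 0\<close> has minimum
  \<open>rho t lam\<close>, by \<open>ln u \<le> u - 1\<close>. So the M-criterion is the profile of the PWLS criterion
  and the two have the same minimising \<open>\<beta>\<close>.\<close>

lemma rho_le_weighted_square:
  assumes "lam > 0" "w > 0"
  shows "rho t lam \<le> w\<^sup>2 * t\<^sup>2 + lam * \<bar>ln w\<bar>"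
proof (cases "\<bar>t\<bar> > sqrt (lam / 2)")
  case True
  \<comment> \<open>The rescaled residual \<open>u\<close> puts the threshold at
    \<open>u = 1\<close> and turns the logarithmic branch of \<open>rho\<close> into
    \<open>lam * ln u + lam / 2\<close>.\<close>
  define u where "u = \<bar>t\<bar> * sqrt (2 / lam)"
  have "\<bar>t\<bar> > 0"
    using True assms(1) by (smt (verit) real_sqrt_ge_zero divide_nonneg_pos)
  then have u: "u > 0"
    using assms(1) by (simp add: u_def)
  have u2: "lam * u\<^sup>2 = 2 * t\<^sup>2"
    using assms(1) by (simp add: u_def power_mult_distrib)
  \<comment> \<open>The bound \<open>ln z \<le> z - 1\<close> is used at
    \<open>z = (w * u)\<^sup>2\<close>, so it is tight exactly at \<open>w = 1 / u\<close>.\<close>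
  have "2 * (ln w + ln u) = ln ((w * u)\<^sup>2)"
    using u assms(2) by (simp add: ln_mult ln_realpow)
  also have "\<dots> \<le> (w * u)\<^sup>2 - 1"
    using u assms(2) by (intro ln_le_minus_one) simp
  finally have "lam * (2 * (ln w + ln u)) \<le> lam * ((w * u)\<^sup>2 - 1)"
    using assms(1) by (intro mult_left_mono) auto
  also have "\<dots> = w\<^sup>2 * (lam * u\<^sup>2) - lam"
    by (simp add: power_mult_distrib algebra_simps)
  finally have "lam * ln u + lam / 2 \<le> w\<^sup>2 * t\<^sup>2 + lam * (- ln w)"
    by (simp add: u2 algebra_simps)
  also have "\<dots> \<le> w\<^sup>2 * t\<^sup>2 + lam * \<bar>ln w\<bar>"
    using assms(1) by (intro add_left_mono mult_left_mono) auto
  finally show ?thesis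
    using True by (simp add: rho_def u_def)
next
  case False
  then have rho: "rho t lam = t\<^sup>2"
    by (simp add: rho_def)
  show ?thesis
  proof (cases "w \<ge> 1")
    case True
    then have "1 * t\<^sup>2 \<le> w\<^sup>2 * t\<^sup>2"
      by (intro mult_right_mono) auto
    moreover have "0 \<le> lam * \<bar>ln w\<bar>"
      using assms(1) by simp
    ultimately show ?thesis
      by (simp add: rho)
  next
    case w: False
    \<comment> \<open>For \<open>w < 1\<close> the claim rearranges to
      \<open>t\<^sup>2 * (1 - w\<^sup>2) \<le> lam * \<bar>ln w\<bar>\<close>. The worst case is
      \<open>t\<^sup>2 = lam / 2\<close>, which the logarithm bound at \<open>w\<^sup>2\<close>
      settles.\<close>
    have "t\<^sup>2 \<le> lam / 2"
      using False by (metis not_less real_sqrt_abs real_sqrt_le_iff)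
    then have "t\<^sup>2 * (1 - w\<^sup>2) \<le> lam / 2 * (1 - w\<^sup>2)"
      using w assms(2) by (intro mult_right_mono) (auto simp: power_le_one)
    also have "2 * ln w \<le> w\<^sup>2 - 1"
      using ln_le_minus_one[of "w\<^sup>2"] assms(2) by (simp add: ln_realpow)
    then have "lam / 2 * (1 - w\<^sup>2) \<le> lam / 2 * (2 * \<bar>ln w\<bar>)"
      using assms(1) by (intro mult_left_mono) auto
    finally show ?thesis
      by (simp add: rho algebra_simps)
  qed
qed

text \<open>The optimal weight is the reciprocal of the rescaled residual beyond the threshold, and
  1, which costs no penalty, below it.\<close>

lemma rho_eq_weighted_square:
  assumes "lam > 0"
  obtains w where "w > 0" "w\<^sup>2 * t\<^sup>2 + lam * \<bar>ln w\<bar> = rho t lam"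
proof (cases "\<bar>t\<bar> > sqrt (lam / 2)")
  case True
  define u where "u = \<bar>t\<bar> * sqrt (2 / lam)"
  \<comment> \<open>The left side equals 1. Knowing \<open>u > 1\<close> puts the weight
    \<open>1 / u\<close> below 1, which fixes the sign of its logarithm.\<close>
  have "sqrt (lam / 2) * sqrt (2 / lam) < u"
    unfolding u_def using True assms by (intro mult_strict_right_mono) auto
  then have u: "u > 1"
    using assms by (simp flip: real_sqrt_mult)
  have "lam * u\<^sup>2 = 2 * t\<^sup>2"
    using assms by (simp add: u_def power_mult_distrib)
  then have "(1 / u)\<^sup>2 * t\<^sup>2 = lam / 2"
    using u by (simp add: field_simps)
  moreover have "\<bar>ln (1 / u)\<bar> = ln u"
    using u by (simp add: ln_div)
  ultimately have "(1 / u)\<^sup>2 * t\<^sup>2 + lam * \<bar>ln (1 / u)\<bar> = rho t lam"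
    using True by (simp add: rho_def u_def)
  with u show thesis
    by (intro that[of "1 / u"]) auto
next
  case False
  then show thesis
    by (intro that[of 1]) (auto simp: rho_def)
qed

text \<open>Moving the scale into the residuals decouples the weights: each occurs in a single
  summand, of the form bounded by \<open>rho\<close>.\<close>

lemma PWLS_objective_eq:
  "PWLS_objective y x lam c (\<beta>, \<sigma>, w) =
     (\<Sum>i\<in>UNIV. (w $ i)\<^sup>2 * ((y $ i - x $ i \<bullet> \<beta>) / \<sigma>)\<^sup>2 + lam * \<bar>ln (w $ i)\<bar>)
       + 2 * c * real CARD('n) * ln \<sigma>"
  for y :: "real ^ 'n"
  by (simp add: PWLS_objective_def sum.distrib sum_distrib_left power_divide)

lemma M_objective_le_PWLS_objective:
  assumes "lam > 0" "\<And>i. w $ i > 0"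
  shows "M_objective y x lam c (\<beta>, \<sigma>) \<le> PWLS_objective y x lam c (\<beta>, \<sigma>, w)"
  unfolding PWLS_objective_eq M_objective_def
  using assms by (auto intro!: sum_mono rho_le_weighted_square)

lemma PWLS_objective_attains_M_objective:
  fixes y :: "real ^ 'n"
  assumes "lam > 0"
  obtains w where "\<And>i. w $ i > 0"
    "PWLS_objective y x lam c (\<beta>, \<sigma>, w) = M_objective y x lam c (\<beta>, \<sigma>)"
proof -
  have "\<exists>v. v > 0 \<and> v\<^sup>2 * t\<^sup>2 + lam * \<bar>ln v\<bar> = rho t lam" for t
    using rho_eq_weighted_square[OF assms] by metis
  then obtain v where v: "\<And>t. v t > 0" "\<And>t. (v t)\<^sup>2 * t\<^sup>2 + lam * \<bar>ln (v t)\<bar> = rho t lam"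
    by metis
  show thesis
    \<comment> \<open>The pointwise optimal weights, one for each scaled residual, are assembled
      into a vector.\<close>
    by (rule that[of "\<chi> i. v ((y $ i - x $ i \<bullet> \<beta>) / \<sigma>)"])
      (simp_all only: PWLS_objective_eq M_objective_def vec_lambda_beta v case_prod_conv)
qed

theorem theorem1:
  fixes y :: "real ^ 'n" and x :: "real ^ 'p ^ 'n"
    and lam c :: real and \<beta> :: "real ^ 'p"
  assumes "lam > 0"
  shows "(\<exists>\<sigma>. is_M_minimizer y x lam c (\<beta>, \<sigma>)) \<longleftrightarrow>
         (\<exists>\<sigma> w. is_PWLS_minimizer y x lam c (\<beta>, \<sigma>, w))"
proof
  assume "\<exists>\<sigma>. is_M_minimizer y x lam c (\<beta>, \<sigma>)"
  then obtain \<sigma> where \<sigma>: "\<sigma> > 0"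
    and min: "\<And>\<beta>' \<sigma>'. \<sigma>' > 0 \<Longrightarrow> M_objective y x lam c (\<beta>, \<sigma>) \<le> M_objective y x lam c (\<beta>', \<sigma>')"
    by (auto simp: is_M_minimizer_def is_arg_min_linorder)
  obtain w where w: "\<And>i. w $ i > 0"
    "PWLS_objective y x lam c (\<beta>, \<sigma>, w) = M_objective y x lam c (\<beta>, \<sigma>)"
    using PWLS_objective_attains_M_objective[OF assms] by metis
  have "PWLS_objective y x lam c (\<beta>, \<sigma>, w) \<le> PWLS_objective y x lam c (\<beta>', \<sigma>', w')"
    if "\<sigma>' > 0" "\<forall>i. w' $ i > 0" for \<beta>' \<sigma>' w'
    \<comment> \<open>The chain passes through M at \<open>(\<beta>', \<sigma>')\<close>, which lies
      below PWLS for every positive \<open>w'\<close>.\<close>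
    unfolding w(2) using that
    by (intro order_trans[OF min M_objective_le_PWLS_objective[OF assms]]) auto
  then have "is_PWLS_minimizer y x lam c (\<beta>, \<sigma>, w)"
    using \<sigma> w(1) by (auto simp: is_PWLS_minimizer_def is_arg_min_linorder)
  then show "\<exists>\<sigma> w. is_PWLS_minimizer y x lam c (\<beta>, \<sigma>, w)"
    by blast
next
  assume "\<exists>\<sigma> w. is_PWLS_minimizer y x lam c (\<beta>, \<sigma>, w)"
  then obtain \<sigma> w where \<sigma>: "\<sigma> > 0" and w: "\<forall>i. w $ i > 0"
    and min: "\<And>\<beta>' \<sigma>' w'. \<sigma>' > 0 \<Longrightarrow> \<forall>i. w' $ i > 0 \<Longrightarrow>
      PWLS_objective y x lam c (\<beta>, \<sigma>, w) \<le> PWLS_objective y x lam c (\<beta>', \<sigma>', w')"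
    by (auto simp: is_PWLS_minimizer_def is_arg_min_linorder)
  have "M_objective y x lam c (\<beta>, \<sigma>) \<le> M_objective y x lam c (\<beta>', \<sigma>')" if "\<sigma>' > 0" for \<beta>' \<sigma>'
  proof -
    \<comment> \<open>Optimal weights for the competitor turn its M-value into a PWLS-value, to
      which minimality of \<open>(\<beta>, \<sigma>, w)\<close> applies.\<close>
    obtain w' where w': "\<forall>i. w' $ i > 0"
      "PWLS_objective y x lam c (\<beta>', \<sigma>', w') = M_objective y x lam c (\<beta>', \<sigma>')"
      using PWLS_objective_attains_M_objective[OF assms] by metis
    then show ?thesis
      using order_trans[OF M_objective_le_PWLS_objective[OF assms w[rule_format]]
        min[OF that w'(1), of \<beta>']]
      by (simp only: w'(2))
  qed
  then have "is_M_minimizer y x lam c (\<beta>, \<sigma>)"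
    using \<sigma> by (auto simp: is_M_minimizer_def is_arg_min_linorder)
  then show "\<exists>\<sigma>. is_M_minimizer y x lam c (\<beta>, \<sigma>)"
    by blast
qed

end
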